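(* Let $(\alpha,\rho)\in\mathcal{A}$ and let $X_{\alpha,\rho}$ be a real random variable with the free stable distribution $\nu_{\alpha,\rho}$. Then $\mathbb{P}(X_{\alpha,\rho}>0)=\rho$.
   Context: The set of admissible parameters is $$\mathcal{A}=\{(\alpha,\rho):\alpha\in(0,1),\ \rho\in[0,1]\}\cup\{(\alpha,\rho):\alpha\in(1,2],\ \rho\in[1-\alpha^{-1},\alpha^{-1}]\}.$$ All powers use the principal branch. For $(\alpha,\rho)\in\mathcal{A}$, the free stable distribution $\nu_{\alpha,\rho}$ is the probability measure on $\mathbb{R}$ (known to exist and be unique) whose Voiculescu transform is $\phi_{\alpha,\rho}(z)=-e^{\pi i\alpha\rho}z^{-\alpha+1}$ for $\operatorname{Im}(z)>0$. This means that its Cauchy transform $G_{\alpha,\rho}(z)=\int_{\mathbb{R}}\frac{\nu_{\alpha,\rho}(dx)}{z-x}$, $\operatorname{Im}(z)>0$ (which takes values in the lower half-plane), is the inverse function of $w\mapsto \frac1w+\phi_{\alpha,\rho}(\frac1w)$, i.e. $w=G_{\alpha,\rho}(z)$ satisfies $z=w^{-1}-e^{\pi i\alpha\rho}w^{\alpha-1}$ for all $z$ with $\operatorname{Im}(z)>0$. *)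

theory Defs
  imports "HOL-Probability.Probability"
begin

definition admissible :: "(real \<times> real) set" where
  "admissible = {(\<alpha>, \<rho>). \<alpha> \<in> {0<..<1} \<and> \<rho> \<in> {0..1}} \<union>
                {(\<alpha>, \<rho>). \<alpha> \<in> {1<..2} \<and> \<rho> \<in> {1 - 1 / \<alpha>..1 / \<alpha>}}"

definition cauchy_transform :: "real measure \<Rightarrow> complex \<Rightarrow> complex" where
  "cauchy_transform \<nu> z = (\<integral>x. 1 / (z - complex_of_real x) \<partial>\<nu>)"

text \<open>
  This is the Voiculescu transform of a measure for which it extends to the whole upper
  half-plane: the Cauchy transform is inverted by the map sending \<open>w\<close> to \<open>1 / w + \<phi> (1 / w)\<close>.
  Only values of \<open>\<phi>\<close> on the upper half-plane matter, since the Cauchy transform of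
  a probability measure maps the upper half-plane into the lower one.
\<close>
definition has_voiculescu_transform ::
    "real measure \<Rightarrow> (complex \<Rightarrow> complex) \<Rightarrow> bool" where
  "has_voiculescu_transform \<nu> \<phi> \<longleftrightarrow>
     (\<forall>z. Im z > 0 \<longrightarrow>
        (let w = cauchy_transform \<nu> z in z = 1 / w + \<phi> (1 / w)))"

text \<open>On complex numbers, \<open>powr\<close> is the principal branch.\<close>
definition free_stable_voiculescu :: "real \<Rightarrow> real \<Rightarrow> complex \<Rightarrow> complex" where
  "free_stable_voiculescu \<alpha> \<rho> z =
     - exp (\<i> * complex_of_real (pi * \<alpha> * \<rho>)) * z powr complex_of_real (1 - \<alpha>)"

definition free_stable_distribution :: "real \<Rightarrow> real \<Rightarrow> real measure \<Rightarrow> bool" where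
  "free_stable_distribution \<alpha> \<rho> \<nu> \<longleftrightarrow>
     real_distribution \<nu> \<and> has_voiculescu_transform \<nu> (free_stable_voiculescu \<alpha> \<rho>)"

lemma free_stable_voiculescu_inverse:
  assumes "Im w < 0"
  shows "1 / w + free_stable_voiculescu \<alpha> \<rho> (1 / w) =
         1 / w - exp (\<i> * complex_of_real (pi * \<alpha> * \<rho>)) * w powr complex_of_real (\<alpha> - 1)"
proof -
  from assms have "w \<noteq> 0" and "w \<notin> \<real>\<^sub>\<le>\<^sub>0"
    by (auto simp: complex_nonpos_Reals_iff)
  then have "(1 / w) powr complex_of_real (1 - \<alpha>) = w powr complex_of_real (\<alpha> - 1)"
    by (simp add: powr_def Ln_inverse divide_inverse algebra_simps)
  then show ?thesis
    by (simp add: free_stable_voiculescu_def)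
qed

end

theory Submission
  imports Defs
begin

text \<open>
  Let \<open>G\<close> be the Cauchy transform of the free stable law \<open>\<nu>\<close>. The mass of the positive half-line
  can be read off from \<open>F y = \<integral> arctan (x / y) d\<nu>(x)\<close>: by dominated convergence \<open>F\<close> tends to
  \<open>0\<close> as \<open>y\<close> tends to infinity and, if \<open>\<nu>\<close> has no atom at \<open>0\<close>, to \<open>\<pi> \<nu>(0, \<infinity>) - \<pi> / 2\<close> as
  \<open>y\<close> tends to \<open>0\<close>. Moreover \<open>F' y = Re (G (\<i> y))\<close>, so the limit at \<open>0\<close> is found by
  integrating \<open>G\<close> along the imaginary axis.

  That integral is explicit, because \<open>\<integral> w dz = w z - \<integral> z dw\<close> and the Voiculescu transform gives
  \<open>z\<close> as an elementary function of \<open>w = G z\<close>, namely \<open>z w = 1 - E w\<^sup>\<alpha>\<close> with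
  \<open>E = exp (\<pi> \<i> \<alpha> \<rho>)\<close>. The outcome is the antiderivative
  \<open>K z = (1 / \<alpha> - 1) (1 - z G z) - Ln (G z)\<close> of \<open>G\<close>
  (lemma \<open>has_field_derivative_free_stable_primitive\<close>), and \<open>F y\<close> differs from \<open>Im (K (\<i> y))\<close> by
  a constant (lemma \<open>integral_arctan_eq_Im_primitive\<close>).

  At infinity \<open>z G z\<close> tends to \<open>1\<close>, so \<open>Im K\<close> tends to \<open>\<pi> / 2\<close> and the constant is
  \<open>- \<pi> / 2\<close>. At \<open>0\<close> the product \<open>z G z\<close> tends to \<open>\<nu> {0}\<close>. This is \<open>0\<close>: otherwise
  \<open>|G z|\<close> would be unbounded, whereas \<open>|G z|\<^sup>\<alpha> = |1 - z G z|\<close> is bounded. Hence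
  \<open>E (G z)\<^sup>\<alpha>\<close> tends to \<open>1\<close>. Admissibility of \<open>(\<alpha>, \<rho>)\<close> keeps the exponent
  \<open>\<pi> \<i> \<alpha> \<rho> + \<alpha> Ln (G z)\<close> inside the strip where \<open>Ln\<close> inverts \<open>exp\<close> (lemma
  \<open>free_stable_Ln_eq\<close>), so this exponent tends to \<open>0\<close>, \<open>Ln (G z)\<close> tends to \<open>- \<i> \<pi> \<rho>\<close>, and
  \<open>Im K\<close> tends to \<open>\<pi> \<rho>\<close>. Comparing the two expressions for the limit of \<open>F\<close> at \<open>0\<close> gives
  \<open>\<nu>(0, \<infinity>) = \<rho>\<close>.
\<close>

section \<open>Differentiation under the integral sign\<close>

text \<open>
  On a convex set the bound on the derivative bounds all difference quotients, so dominated
  convergence applies to them.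
\<close>
lemma (in finite_measure) has_field_derivative_integral:
  fixes f f' :: "'b::{real_normed_field, banach, second_countable_topology} \<Rightarrow> 'a \<Rightarrow> 'b"
  assumes S: "open S" "convex S" "t \<in> S"
    and int: "\<And>s. s \<in> S \<Longrightarrow> integrable M (f s)"
    and meas: "f' t \<in> borel_measurable M"
    and deriv: "\<And>s x. s \<in> S \<Longrightarrow> x \<in> space M \<Longrightarrow> ((\<lambda>s. f s x) has_field_derivative f' s x) (at s)"
    and bound: "\<And>s x. s \<in> S \<Longrightarrow> x \<in> space M \<Longrightarrow> norm (f' s x) \<le> B"
  shows "((\<lambda>s. \<integral>x. f s x \<partial>M) has_field_derivative (\<integral>x. f' t x \<partial>M)) (at t)"
proof -
  have "((\<lambda>s. ((\<integral>x. f s x \<partial>M) - (\<integral>x. f t x \<partial>M)) / (s - t)) \<longlongrightarrow> (\<integral>x. f' t x \<partial>M)) (at t within S)"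
    unfolding tendsto_at_iff_sequentially comp_def
  proof (intro allI impI)
    fix s :: "nat \<Rightarrow> 'b"
    assume s: "\<forall>i. s i \<in> S - {t}" "s \<longlonglongrightarrow> t"
    have eq: "((\<integral>x. f (s n) x \<partial>M) - (\<integral>x. f t x \<partial>M)) / (s n - t)
        = (\<integral>x. (f (s n) x - f t x) / (s n - t) \<partial>M)" for n
      using s(1) S(3) by (simp add: Bochner_Integration.integral_diff int)
    have "(\<lambda>n. \<integral>x. (f (s n) x - f t x) / (s n - t) \<partial>M) \<longlonglongrightarrow> (\<integral>x. f' t x \<partial>M)"
    proof (rule integral_dominated_convergence[where w = "\<lambda>_. B"])
      show "AE x in M. (\<lambda>n. (f (s n) x - f t x) / (s n - t)) \<longlonglongrightarrow> f' t x"
      proof (rule AE_I2)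
        fix x assume "x \<in> space M"
        from deriv[OF S(3) this] have "((\<lambda>s. (f s x - f t x) / (s - t)) \<longlongrightarrow> f' t x) (at t)"
          by (simp add: has_field_derivative_iff)
        then show "(\<lambda>n. (f (s n) x - f t x) / (s n - t)) \<longlonglongrightarrow> f' t x"
          using s unfolding tendsto_at_iff_sequentially comp_def by auto
      qed
      show "AE x in M. norm ((f (s n) x - f t x) / (s n - t)) \<le> B" for n
      proof (rule AE_I2)
        fix x assume x: "x \<in> space M"
        have "norm (f (s n) x - f t x) \<le> B * norm (s n - t)"
          using s(1) S x
          by (intro field_differentiable_bound[where S = S and f' = "\<lambda>s. f' s x"])
             (auto intro: DERIV_subset deriv bound)
        then show "norm ((f (s n) x - f t x) / (s n - t)) \<le> B"
          using s(1) by (simp add: norm_divide divide_simps)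
      qed
      show "(\<lambda>x. (f (s n) x - f t x) / (s n - t)) \<in> borel_measurable M" for n
        using s(1) S(3) int by (intro borel_measurable_divide borel_measurable_diff) auto
    qed (use meas in auto)
    then show "(\<lambda>n. ((\<integral>x. f (s n) x \<partial>M) - (\<integral>x. f t x \<partial>M)) / (s n - t)) \<longlonglongrightarrow> (\<integral>x. f' t x \<partial>M)"
      by (simp only: eq)
  qed
  then show ?thesis
    by (simp only: has_field_derivative_iff at_within_open[OF S(3,1)])
qed

section \<open>The Cauchy transform on the imaginary axis\<close>

lemma abs_arctan_le: "\<bar>arctan x\<bar> \<le> pi / 2"
  using arctan_bounded[of x] by linarith

lemma cauchy_kernel_bound:
  assumes "0 < c" "c \<le> Im z"
  shows "norm (1 / (z - complex_of_real x)) \<le> 1 / c"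
proof -
  have "c \<le> norm (z - complex_of_real x)"
    using abs_Im_le_cmod[of "z - complex_of_real x"] assms by simp
  with assms show ?thesis
    by (simp add: norm_divide frac_le)
qed

context real_distribution
begin

lemma integrable_cauchy_kernel:
  assumes "Im z > 0"
  shows "integrable M (\<lambda>x. 1 / (z - complex_of_real x))"
proof (rule integrable_const_bound[where B = "1 / Im z"])
  show "AE x in M. norm (1 / (z - complex_of_real x)) \<le> 1 / Im z"
    using cauchy_kernel_bound[of "Im z" z] assms by blast
qed measurable

lemma Im_cauchy_transform_neg:
  assumes "Im z > 0"
  shows "Im (cauchy_transform M z) < 0"
proof -
  note int = integrable_cauchy_kernel[OF assms]
  have "(\<integral>x. Im (1 / (z - complex_of_real x)) \<partial>M) < 0"
  proof (rule expectation_less)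
    show "integrable M (\<lambda>x. Im (1 / (z - complex_of_real x)))"
      by (rule integrable_Im[OF int])
    have "Im (1 / (z - complex_of_real x)) < 0" for x
      using assms by (simp add: Im_divide divide_less_0_iff sum_power2_gt_zero_iff)
    then show "AE x in M. Im (1 / (z - complex_of_real x)) < 0"
      by simp
  qed
  then show ?thesis
    using integral_Im[OF int] by (simp add: cauchy_transform_def)
qed

text \<open>
  The half-plane of points with imaginary part above \<open>Im z / 2\<close> is a convex neighbourhood of \<open>z\<close>
  that stays away from the real line, so the derivative of the kernel is bounded there.
\<close>
lemma cauchy_transform_differentiable:
  assumes "Im z > 0"
  obtains D where "(cauchy_transform M has_field_derivative D) (at z)"
proof -
  have "((\<lambda>s. \<integral>x. 1 / (s - complex_of_real x) \<partial>M) has_field_derivative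
      (\<integral>x. - 1 / (z - complex_of_real x)\<^sup>2 \<partial>M)) (at z)"
  proof (rule has_field_derivative_integral[where S = "{s. Im z / 2 < Im s}"
        and B = "(1 / (Im z / 2))\<^sup>2" and f' = "\<lambda>s x. - 1 / (s - complex_of_real x)\<^sup>2"])
    show "open {s. Im z / 2 < Im s}" "convex {s. Im z / 2 < Im s}"
      by (rule open_halfspace_Im_gt, rule convex_halfspace_Im_gt)
    show "z \<in> {s. Im z / 2 < Im s}" using assms by simp
    fix s assume s: "s \<in> {s. Im z / 2 < Im s}"
    then show "integrable M (\<lambda>x. 1 / (s - complex_of_real x))"
      using assms by (intro integrable_cauchy_kernel) auto
    fix x
    have "s \<noteq> complex_of_real x" using s assms by auto
    then show "((\<lambda>s. 1 / (s - complex_of_real x)) has_field_derivative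
        - 1 / (s - complex_of_real x)\<^sup>2) (at s)"
      by (auto intro!: derivative_eq_intros simp: power2_eq_square divide_simps)
    have "norm (1 / (s - complex_of_real x)) ^ 2 \<le> (1 / (Im z / 2)) ^ 2"
      using s assms by (intro power_mono cauchy_kernel_bound) auto
    then show "norm (- 1 / (s - complex_of_real x)\<^sup>2) \<le> (1 / (Im z / 2))\<^sup>2"
      by (simp add: norm_divide norm_power power_divide)
  qed auto
  then show ?thesis
    using that by (simp add: cauchy_transform_def[abs_def])
qed

text \<open>
  On the imaginary axis the kernel \<open>z / (z - x)\<close> of \<open>z G z\<close> is bounded by \<open>1\<close>, so the boundary
  behaviour of \<open>z G z\<close> follows from the pointwise limit of the kernel.
\<close>
lemma tendsto_vertical_cauchy_transform:
  assumes y: "\<And>n. 0 < y n"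
    and lim: "\<And>x. (\<lambda>n. \<i> * complex_of_real (y n) / (\<i> * complex_of_real (y n) - complex_of_real x)) \<longlonglongrightarrow> g x"
    and [measurable]: "g \<in> borel_measurable borel"
  shows "(\<lambda>n. \<i> * complex_of_real (y n) * cauchy_transform M (\<i> * complex_of_real (y n)))
    \<longlonglongrightarrow> (\<integral>x. g x \<partial>M)"
proof -
  let ?z = "\<lambda>n. \<i> * complex_of_real (y n)"
  have "(\<lambda>n. \<integral>x. ?z n / (?z n - complex_of_real x) \<partial>M) \<longlonglongrightarrow> (\<integral>x. g x \<partial>M)"
  proof (rule integral_dominated_convergence[where w = "\<lambda>_. 1"])
    have "norm (?z n / (?z n - complex_of_real x)) \<le> 1" for n x
      using mult_left_mono[OF cauchy_kernel_bound[of "y n" "?z n" x], of "y n"] y[of n]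
      by (simp add: norm_divide norm_mult)
    then show "AE x in M. norm (?z n / (?z n - complex_of_real x)) \<le> 1" for n
      by simp
  qed (use lim in auto)
  moreover have "(\<integral>x. ?z n / (?z n - complex_of_real x) \<partial>M) = ?z n * cauchy_transform M (?z n)" for n
    unfolding cauchy_transform_def
    by (subst integral_mult_right_zero[symmetric]) (simp add: divide_inverse)
  ultimately show ?thesis by simp
qed

lemma vertical_cauchy_transform_at_infinity:
  "(\<lambda>n. \<i> * complex_of_real (real (Suc n)) * cauchy_transform M (\<i> * complex_of_real (real (Suc n))))
    \<longlonglongrightarrow> 1"
proof -
  have "(\<lambda>n. \<i> * complex_of_real (real (Suc n)) /
      (\<i> * complex_of_real (real (Suc n)) - complex_of_real x)) \<longlonglongrightarrow> 1" for x
  proof -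
    have "(\<lambda>n. \<i> / (\<i> - complex_of_real x * complex_of_real (inverse (real (Suc n))))) \<longlonglongrightarrow>
        \<i> / (\<i> - complex_of_real x * complex_of_real 0)"
      by (intro tendsto_intros LIMSEQ_inverse_real_of_nat) auto
    moreover have "\<i> / (\<i> - complex_of_real x * complex_of_real (inverse (real (Suc n)))) =
      \<i> * complex_of_real (real (Suc n)) / (\<i> * complex_of_real (real (Suc n)) - complex_of_real x)" for n
      using of_nat_neq_0[of n, where 'a = complex] 
      by (simp add: field_simps del: of_nat_Suc)
    ultimately show ?thesis by simp
  qed
  from tendsto_vertical_cauchy_transform[of "\<lambda>n. real (Suc n)", OF _ this] show ?thesis
    by (simp add: prob_space[simplified])
qed

lemma vertical_cauchy_transform_at_0:
  "(\<lambda>n. \<i> * complex_of_real (1 / real (Suc n)) * cauchy_transform M (\<i> * complex_of_real (1 / real (Suc n))))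
    \<longlonglongrightarrow> complex_of_real (prob {0})"
proof -
  let ?y = "\<lambda>n. 1 / real (Suc n)"
  have y: "?y \<longlonglongrightarrow> 0"
    using LIMSEQ_inverse_real_of_nat by (simp add: divide_inverse)
  have "(\<lambda>n. \<i> * complex_of_real (?y n) / (\<i> * complex_of_real (?y n) - complex_of_real x))
      \<longlonglongrightarrow> indicator {0} x" for x
  proof (cases "x = 0")
    case True
    then show ?thesis by (simp del: of_nat_Suc)
  next
    case False
    then have "(\<lambda>n. \<i> * complex_of_real (?y n) / (\<i> * complex_of_real (?y n) - complex_of_real x))
      \<longlonglongrightarrow> \<i> * complex_of_real 0 / (\<i> * complex_of_real 0 - complex_of_real x)"
      by (intro tendsto_intros y) auto
    with False show ?thesis by simp
  qed
  from tendsto_vertical_cauchy_transform[of ?y, OF _ this]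
  have "(\<lambda>n. \<i> * complex_of_real (?y n) * cauchy_transform M (\<i> * complex_of_real (?y n)))
    \<longlonglongrightarrow> (\<integral>x. indicator {0} x \<partial>M)" by simp
  moreover have "(\<integral>x. indicator {0} x \<partial>M) = complex_of_real (prob {0})"
  proof -
    have "(\<integral>x. indicator {0} x \<partial>M) = (\<integral>x. complex_of_real (indicator {0} x) \<partial>M)"
      by (intro Bochner_Integration.integral_cong) (auto simp: indicator_def)
    then show ?thesis by simp
  qed
  ultimately show ?thesis by simp
qed

section \<open>The arctangent integral\<close>

text \<open>
  Up to the constant \<open>\<pi> / 2\<close>, \<open>arctan (x / y)\<close> is the argument of \<open>\<i> y - x\<close>, that is, the
  imaginary part of a logarithm of \<open>z - x\<close> at \<open>z = \<i> y\<close>; the derivative of that logarithm is the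
  kernel of the Cauchy transform.
\<close>
lemma DERIV_integral_arctan:
  assumes "y > 0"
  shows "((\<lambda>y. \<integral>x. arctan (x / y) \<partial>M) has_real_derivative
    Re (cauchy_transform M (\<i> * complex_of_real y))) (at y)"
proof -
  have eq: "Re (1 / (\<i> * complex_of_real s - complex_of_real x)) = - x / (x\<^sup>2 + s\<^sup>2)" for s x
    by (simp add: Re_divide)
  have "((\<lambda>y. \<integral>x. arctan (x / y) \<partial>M) has_real_derivative
    (\<integral>x. Re (1 / (\<i> * complex_of_real y - complex_of_real x)) \<partial>M)) (at y)"
  proof (rule has_field_derivative_integral[where S = "{y/2<..}" and B = "1 / (y / 2)"
        and f' = "\<lambda>s x. Re (1 / (\<i> * complex_of_real s - complex_of_real x))"])
    fix s assume s: "s \<in> {y/2<..}"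
    show "integrable M (\<lambda>x. arctan (x / s))"
      by (rule integrable_const_bound[where B = "pi / 2"]) (simp_all only: real_norm_def abs_arctan_le AE_I2, auto)
    fix x
    show "((\<lambda>s. arctan (x / s)) has_real_derivative
        Re (1 / (\<i> * complex_of_real s - complex_of_real x))) (at s)"
      unfolding eq using s assms
      by (auto intro!: derivative_eq_intros simp: field_simps power2_eq_square)
    show "norm (Re (1 / (\<i> * complex_of_real s - complex_of_real x))) \<le> 1 / (y / 2)"
      using cauchy_kernel_bound[of "y / 2" "\<i> * complex_of_real s" x] s assms
        abs_Re_le_cmod[of "1 / (\<i> * complex_of_real s - complex_of_real x)"] by simp
  qed (use assms in auto)
  moreover have "(\<integral>x. Re (1 / (\<i> * complex_of_real y - complex_of_real x)) \<partial>M) =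
      Re (cauchy_transform M (\<i> * complex_of_real y))"
    unfolding cauchy_transform_def
    by (rule integral_Re) (use assms in \<open>auto intro!: integrable_cauchy_kernel\<close>)
  ultimately show ?thesis by simp
qed

lemma tendsto_integral_arctan:
  assumes "\<And>x. (\<lambda>n. arctan (x / y n)) \<longlonglongrightarrow> g x" and "g \<in> borel_measurable borel"
  shows "(\<lambda>n. \<integral>x. arctan (x / y n) \<partial>M) \<longlonglongrightarrow> (\<integral>x. g x \<partial>M)"
proof (rule integral_dominated_convergence[where w = "\<lambda>_. pi / 2"])
  show "AE x in M. norm (arctan (x / y n)) \<le> pi / 2" for n
    using abs_arctan_le by simp
qed (use assms in auto)

lemma integral_arctan_at_infinity: "(\<lambda>n. \<integral>x. arctan (x / real (Suc n)) \<partial>M) \<longlonglongrightarrow> 0"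
proof -
  have "(\<lambda>n. arctan (x / real (Suc n))) \<longlonglongrightarrow> 0" for x
  proof -
    have "(\<lambda>n. arctan (x * inverse (real (Suc n)))) \<longlonglongrightarrow> arctan (x * 0)"
      by (intro tendsto_intros LIMSEQ_inverse_real_of_nat)
    then show ?thesis by (simp add: divide_inverse)
  qed
  from tendsto_integral_arctan[OF this] show ?thesis by simp
qed

text \<open>
  The integrand tends to \<open>\<pi> / 2 * sgn x\<close>, which agrees with \<open>\<pi> * indicator {0<..} x - \<pi> / 2\<close>
  except at \<open>0\<close>.
\<close>
lemma integral_arctan_at_0:
  assumes "prob {0} = 0"
  shows "(\<lambda>n. \<integral>x. arctan (x / (1 / real (Suc n))) \<partial>M) \<longlonglongrightarrow> pi * prob {0<..} - pi / 2"
proof -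
  have top: "filterlim (\<lambda>n. real (Suc n)) at_top sequentially"
    using filterlim_compose[OF filterlim_real_sequentially filterlim_Suc] .
  have "(\<lambda>n. arctan (x / (1 / real (Suc n)))) \<longlonglongrightarrow> pi / 2 * sgn x" for x
  proof -
    consider "x = 0" | "x > 0" | "x < 0" by linarith
    then show ?thesis
    proof cases
      case 2
      with filterlim_compose[OF tendsto_arctan_at_top filterlim_tendsto_pos_mult_at_top[OF tendsto_const 2 top]]
      show ?thesis by simp
    next
      case 3
      with filterlim_compose[OF tendsto_arctan_at_bot filterlim_tendsto_neg_mult_at_bot[OF tendsto_const 3 top]]
      show ?thesis by simp
    qed simp
  qed
  from tendsto_integral_arctan[OF this]
  have "(\<lambda>n. \<integral>x. arctan (x / (1 / real (Suc n))) \<partial>M) \<longlonglongrightarrow> (\<integral>x. pi / 2 * sgn x \<partial>M)" by simp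
  moreover have "(\<integral>x. pi / 2 * sgn x \<partial>M) = (\<integral>x. pi * indicator {0<..} x - pi / 2 \<partial>M)"
  proof (rule integral_cong_AE)
    have "AE x in M. x \<noteq> 0"
      using assms by (intro AE_I[where N = "{0}"]) (auto simp: emeasure_eq_measure)
    then show "AE x in M. pi / 2 * sgn x = pi * indicator {0<..} x - pi / 2"
      by eventually_elim (auto simp: sgn_if)
  qed auto
  moreover have "\<dots> = pi * prob {0<..} - pi / 2"
    by (subst Bochner_Integration.integral_diff) (auto simp: prob_space[simplified] emeasure_eq_measure)
  ultimately show ?thesis by (simp only:)
qed

end

section \<open>The functional equation of the free stable Cauchy transform\<close>

text \<open>
  For \<open>w\<close> in the lower half-plane, \<open>\<pi> \<alpha> \<rho>\<close> and \<open>- \<pi> \<alpha> (1 - \<rho>)\<close> bound the imaginary part of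
  \<open>\<pi> \<i> \<alpha> \<rho> + \<alpha> Ln w\<close>; the inequalities confine it to the range of the principal logarithm.
\<close>
lemma admissible_bounds:
  assumes "(\<alpha>, \<rho>) \<in> admissible"
  shows "0 < \<alpha>" "\<alpha> * \<rho> \<le> 1" "\<alpha> * (1 - \<rho>) \<le> 1" "0 \<le> \<rho>" "\<rho> \<le> 1"
proof -
  consider "0 < \<alpha>" "\<alpha> < 1" "0 \<le> \<rho>" "\<rho> \<le> 1" | "1 < \<alpha>" "1 - 1 / \<alpha> \<le> \<rho>" "\<rho> \<le> 1 / \<alpha>"
    using assms by (auto simp: admissible_def)
  then have "0 < \<alpha> \<and> \<alpha> * \<rho> \<le> 1 \<and> \<alpha> * (1 - \<rho>) \<le> 1 \<and> 0 \<le> \<rho> \<and> \<rho> \<le> 1"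
  proof cases
    case 1
    then show ?thesis by (auto intro: mult_le_one)
  next
    case 2
    have "1 / \<alpha> < 1" using 2 by simp
    with 2 have "0 \<le> \<rho>" "\<rho> \<le> 1" by linarith+
    with 2 show ?thesis by (simp add: field_simps)
  qed
  then show "0 < \<alpha>" "\<alpha> * \<rho> \<le> 1" "\<alpha> * (1 - \<rho>) \<le> 1" "0 \<le> \<rho>" "\<rho> \<le> 1" by auto
qed

text \<open>
  This is the equation of the Voiculescu transform multiplied by \<open>G z\<close>. Writing the power as an
  exponential prepares both for differentiating it and for taking its logarithm.
\<close>
lemma free_stable_cauchy_transform_eq:
  assumes "free_stable_distribution \<alpha> \<rho> \<nu>" and "Im z > 0"
  shows "1 - z * cauchy_transform \<nu> z =
    exp (\<i> * complex_of_real (pi * \<alpha> * \<rho>) + complex_of_real \<alpha> * Ln (cauchy_transform \<nu> z))"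
proof -
  interpret real_distribution \<nu>
    using assms by (simp add: free_stable_distribution_def)
  define w where "w = cauchy_transform \<nu> z"
  have w: "Im w < 0" "w \<noteq> 0"
    using Im_cauchy_transform_neg[OF assms(2)] by (auto simp: w_def)
  have "z = 1 / w + free_stable_voiculescu \<alpha> \<rho> (1 / w)"
    using assms by (auto simp: free_stable_distribution_def has_voiculescu_transform_def Let_def w_def)
  also have "\<dots> = 1 / w - exp (\<i> * complex_of_real (pi * \<alpha> * \<rho>)) * w powr complex_of_real (\<alpha> - 1)"
    by (rule free_stable_voiculescu_inverse[OF w(1)])
  finally have "z * w = (1 / w - exp (\<i> * complex_of_real (pi * \<alpha> * \<rho>)) * w powr complex_of_real (\<alpha> - 1)) * w"
    by (rule arg_cong)
  then have "1 - z * w = exp (\<i> * complex_of_real (pi * \<alpha> * \<rho>)) * (w powr complex_of_real (\<alpha> - 1) * w)"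
    using w(2) by (simp add: left_diff_distrib mult.assoc)
  also have "w powr complex_of_real (\<alpha> - 1) * w = w powr complex_of_real \<alpha>"
    using w(2) by (simp add: powr_diff)
  also have "exp (\<i> * complex_of_real (pi * \<alpha> * \<rho>)) * w powr complex_of_real \<alpha> =
      exp (\<i> * complex_of_real (pi * \<alpha> * \<rho>) + complex_of_real \<alpha> * Ln w)"
    using w(2) by (simp add: powr_def exp_add)
  finally show ?thesis by (simp add: w_def)
qed

text \<open>
  Since \<open>G z\<close> lies in the lower half-plane, the imaginary part of the exponent lies strictly between
  \<open>- \<pi> \<alpha> (1 - \<rho>)\<close> and \<open>\<pi> \<alpha> \<rho>\<close>, hence between \<open>- \<pi>\<close> and \<open>\<pi>\<close> for admissible parameters. No
  multiple of \<open>2 \<pi>\<close> has to be added.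
\<close>
lemma free_stable_Ln_eq:
  assumes adm: "(\<alpha>, \<rho>) \<in> admissible"
    and fs: "free_stable_distribution \<alpha> \<rho> \<nu>" and z: "Im z > 0"
  shows "Ln (1 - z * cauchy_transform \<nu> z) =
    \<i> * complex_of_real (pi * \<alpha> * \<rho>) + complex_of_real \<alpha> * Ln (cauchy_transform \<nu> z)"
proof -
  interpret real_distribution \<nu>
    using fs by (simp add: free_stable_distribution_def)
  let ?\<theta> = "Im (Ln (cauchy_transform \<nu> z))"
  note b = admissible_bounds[OF adm]
  have "Im (cauchy_transform \<nu> z) < 0"
    by (rule Im_cauchy_transform_neg[OF z])
  then have th: "- pi < ?\<theta>" "?\<theta> < 0"
    using mpi_less_Im_Ln[of "cauchy_transform \<nu> z"] Im_Ln_pos_le[of "cauchy_transform \<nu> z"]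
      Im_Ln_le_pi[of "cauchy_transform \<nu> z"] by fastforce+
  have "\<alpha> * (- pi) < \<alpha> * ?\<theta>" "\<alpha> * ?\<theta> < 0"
    using mult_strict_left_mono[OF th(1) b(1)] mult_pos_neg[OF b(1) th(2)] by auto
  moreover have "pi * (\<alpha> * \<rho>) \<le> pi * 1" "pi * (\<alpha> * (1 - \<rho>)) \<le> pi * 1"
    using b by (auto intro!: mult_left_mono simp del: mult_1_right)
  moreover have "0 \<le> pi * (\<alpha> * \<rho>)" "\<alpha> * (- pi) = - pi * (\<alpha> * (1 - \<rho>)) - pi * (\<alpha> * \<rho>)"
    using b by (auto simp: algebra_simps)
  ultimately have "- pi < pi * (\<alpha> * \<rho>) + \<alpha> * ?\<theta>" "pi * (\<alpha> * \<rho>) + \<alpha> * ?\<theta> \<le> pi"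
    by linarith+
  then have "- pi < pi * \<alpha> * \<rho> + \<alpha> * ?\<theta>" "pi * \<alpha> * \<rho> + \<alpha> * ?\<theta> \<le> pi"
    by (simp_all only: mult.assoc)
  then show ?thesis
    unfolding free_stable_cauchy_transform_eq[OF fs z] by (intro Ln_exp) auto
qed

section \<open>An explicit antiderivative of the Cauchy transform\<close>

text \<open>
  Integration by parts gives \<open>z w - \<integral> z dw\<close> with \<open>z = 1 / w - E w\<^bsup>\<alpha> - 1\<^esup>\<close>; replacing
  \<open>E w\<^sup>\<alpha>\<close> by \<open>1 - z w\<close> in the result and dropping a constant leaves the formula below.
\<close>
definition free_stable_primitive :: "real \<Rightarrow> real measure \<Rightarrow> complex \<Rightarrow> complex" where
  "free_stable_primitive \<alpha> \<nu> z =
     complex_of_real (1 / \<alpha> - 1) * (1 - z * cauchy_transform \<nu> z) - Ln (cauchy_transform \<nu> z)"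

text \<open>
  Differentiating the functional equation yields a linear relation for \<open>G'\<close>, which eliminates
  \<open>G'\<close> from the derivative of the primitive.
\<close>
lemma has_field_derivative_free_stable_primitive:
  assumes fs: "free_stable_distribution \<alpha> \<rho> \<nu>" and \<alpha>: "0 < \<alpha>" and z: "Im z > 0"
  shows "(free_stable_primitive \<alpha> \<nu> has_field_derivative cauchy_transform \<nu> z) (at z)"
proof -
  interpret real_distribution \<nu>
    using fs by (simp add: free_stable_distribution_def)
  let ?G = "cauchy_transform \<nu>"
  let ?a = "complex_of_real \<alpha>"
  let ?e = "\<lambda>z. exp (\<i> * complex_of_real (pi * \<alpha> * \<rho>) + ?a * Ln (?G z))"
  obtain D where D: "(?G has_field_derivative D) (at z)"
    using cauchy_transform_differentiable[OF z] .
  have G: "?G z \<notin> \<real>\<^sub>\<le>\<^sub>0" "?G z \<noteq> 0"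
    using Im_cauchy_transform_neg[OF z] by (auto simp: complex_nonpos_Reals_iff)
  have lhs: "((\<lambda>z. 1 - z * ?G z) has_field_derivative - (?G z + z * D)) (at z)"
    by (auto intro!: derivative_eq_intros D)
  have LnG: "((\<lambda>z. Ln (?G z)) has_field_derivative D / ?G z) (at z)"
    using DERIV_chain2[OF has_field_derivative_Ln[OF G(1)] D] by (simp add: divide_inverse mult.commute)
  have "(?e has_field_derivative ?e z * (?a * (D / ?G z))) (at z)"
    using DERIV_fun_exp[OF DERIV_add[OF DERIV_const DERIV_cmult[OF LnG]]] by simp
  then have "((\<lambda>z. 1 - z * ?G z) has_field_derivative ?e z * (?a * (D / ?G z))) (at z)"
    by (rule has_field_derivative_transform_within_open[where S = "{z. Im z > 0}"])
       (use z free_stable_cauchy_transform_eq[OF fs] open_halfspace_Im_gt[of 0] in auto)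
  from DERIV_unique[OF this lhs] have "(1 - z * ?G z) * (?a * (D / ?G z)) = - (?G z + z * D)"
    by (simp only: free_stable_cauchy_transform_eq[OF fs z])
  then have rel: "- (?G z + z * D) * ?G z = (1 - z * ?G z) * ?a * D"
    using G by (simp add: field_simps)
  have "(free_stable_primitive \<alpha> \<nu> has_field_derivative
      complex_of_real (1 / \<alpha> - 1) * (- (?G z + z * D)) - D / ?G z) (at z)"
    unfolding free_stable_primitive_def[abs_def]
    by (intro DERIV_diff DERIV_cmult lhs LnG)
  moreover have "complex_of_real (1 / \<alpha> - 1) * (- (?G z + z * D)) - D / ?G z = ?G z"
  proof -
    \<comment> \<open>Multiplied by \<open>\<alpha> G z\<close>, the identity is polynomial modulo \<open>rel\<close>.\<close>
    have a: "?a \<noteq> 0" "?a * complex_of_real (1 / \<alpha> - 1) = 1 - ?a"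
      using \<alpha> by (simp_all add: right_diff_distrib)
    have "?a * ?G z * (complex_of_real (1 / \<alpha> - 1) * (- (?G z + z * D)) - D / ?G z) =
        (?a * complex_of_real (1 / \<alpha> - 1)) * (- (?G z + z * D) * ?G z) - ?a * (?G z * (D / ?G z))"
      by (simp only: right_diff_distrib mult_ac)
    also have "\<dots> = (- (?G z + z * D) * ?G z) + ?a * (?G z + z * D) * ?G z - ?a * D"
      using G(2) unfolding a(2) by (simp add: algebra_simps)
    also have "\<dots> = ?a * ?G z * ?G z"
      unfolding rel by (simp add: algebra_simps)
    finally show ?thesis by (simp only: mult.assoc mult_left_cancel[OF G(2)] mult_left_cancel[OF a(1)])
  qed
  ultimately show ?thesis by simp
qed

text \<open>
  Both sides have the derivative \<open>Re (G (\<i> y))\<close> with respect to \<open>y\<close>: the real part of \<open>G\<close> is the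
  imaginary part of \<open>\<i> G\<close>, and \<open>\<i>\<close> is the derivative of \<open>\<i> y\<close>.
\<close>
lemma integral_arctan_eq_Im_primitive:
  assumes fs: "free_stable_distribution \<alpha> \<rho> \<nu>" and \<alpha>: "0 < \<alpha>"
  shows "\<exists>c. \<forall>y>0.
    (\<integral>x. arctan (x / y) \<partial>\<nu>) = Im (free_stable_primitive \<alpha> \<nu> (\<i> * complex_of_real y)) + c"
proof -
  interpret real_distribution \<nu>
    using fs by (simp add: free_stable_distribution_def)
  let ?K = "free_stable_primitive \<alpha> \<nu>"
  have K: "((\<lambda>y. Im (?K (\<i> * complex_of_real y))) has_real_derivative
      Re (cauchy_transform \<nu> (\<i> * complex_of_real y))) (at y)" if "0 < y" for y
  proof -
    have i: "((\<lambda>y. \<i> * complex_of_real y) has_vector_derivative \<i>) (at y)"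
      by (auto intro!: derivative_eq_intros has_vector_derivative_real_field)
    have "((?K \<circ> (\<lambda>y. \<i> * complex_of_real y)) has_vector_derivative
        \<i> * cauchy_transform \<nu> (\<i> * complex_of_real y)) (at y)"
      using that by (intro field_vector_diff_chain_at[OF i] has_field_derivative_free_stable_primitive[OF fs \<alpha>]) simp
    from bounded_linear.has_vector_derivative[OF bounded_linear_Im this] show ?thesis
      by (simp add: has_real_derivative_iff_has_vector_derivative o_def)
  qed
  have "\<exists>c. \<forall>y\<in>{0<..}. (\<integral>x. arctan (x / y) \<partial>\<nu>) - Im (?K (\<i> * complex_of_real y)) = c"
  proof (rule has_field_derivative_zero_constant)
    fix y :: real assume "y \<in> {0<..}"
    then show "((\<lambda>y. (\<integral>x. arctan (x / y) \<partial>\<nu>) - Im (?K (\<i> * complex_of_real y))) has_real_derivative 0)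
        (at y within {0<..})"
      using DERIV_diff[OF DERIV_integral_arctan K, of y] by (auto intro: DERIV_subset)
  qed simp
  then obtain c where c: "(\<integral>x. arctan (x / y) \<partial>\<nu>) - Im (?K (\<i> * complex_of_real y)) = c"
    if "0 < y" for y by auto
  show ?thesis
  proof (intro exI[of _ c] allI impI)
    fix y :: real assume "0 < y"
    from c[OF this] show "(\<integral>x. arctan (x / y) \<partial>\<nu>) = Im (?K (\<i> * complex_of_real y)) + c"
      by linarith
  qed
qed


section \<open>Boundary values and the mass of the positive half-line\<close>

text \<open>
  Multiplying \<open>G z\<close> by the positive number \<open>Im z\<close> does not change its argument, and the product
  tends to \<open>- \<i>\<close>.
\<close>
lemma free_stable_primitive_at_infinity:
  assumes "free_stable_distribution \<alpha> \<rho> \<nu>"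
  shows "(\<lambda>n. Im (free_stable_primitive \<alpha> \<nu> (\<i> * complex_of_real (real (Suc n))))) \<longlonglongrightarrow> pi / 2"
proof -
  interpret real_distribution \<nu>
    using assms by (simp add: free_stable_distribution_def)
  define z where "z = (\<lambda>n. \<i> * complex_of_real (real (Suc n)))"
  define w where "w = (\<lambda>n. cauchy_transform \<nu> (z n))"
  have zw: "(\<lambda>n. z n * w n) \<longlonglongrightarrow> 1"
    using vertical_cauchy_transform_at_infinity by (simp add: z_def w_def)
  have w0: "w n \<noteq> 0" for n
    using Im_cauchy_transform_neg[of "z n"] by (auto simp: w_def z_def)
  have "(\<lambda>n. Im (Ln (- \<i> * (z n * w n)))) \<longlonglongrightarrow> Im (Ln (- \<i> * 1))"
    by (intro tendsto_intros zw) (auto simp: complex_nonpos_Reals_iff)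
  moreover have "Im (Ln (- \<i> * (z n * w n))) = Im (Ln (w n))" for n
  proof -
    have "- \<i> * (z n * w n) = complex_of_real (real (Suc n)) * w n"
      by (simp add: z_def algebra_simps)
    then show ?thesis
      using Ln_times_of_real[of "real (Suc n)" "w n"] w0[of n]
      by (simp del: of_nat_Suc)
  qed
  ultimately have "(\<lambda>n. Im (Ln (w n))) \<longlonglongrightarrow> - (pi / 2)"
    by simp
  then have "(\<lambda>n. Im (complex_of_real (1 / \<alpha> - 1) * (1 - z n * w n)) - Im (Ln (w n)))
      \<longlonglongrightarrow> Im (complex_of_real (1 / \<alpha> - 1) * (1 - 1)) - - (pi / 2)"
    by (intro tendsto_intros zw)
  then show ?thesis
    by (simp add: free_stable_primitive_def z_def w_def)
qed

text \<open>
  The convergent sequence \<open>1 - z G z\<close> is bounded, and its modulus is \<open>|G z|\<^sup>\<alpha>\<close>. So \<open>G z\<close> is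
  bounded, and the factor \<open>z\<close> forces the limit \<open>0\<close>.
\<close>
lemma free_stable_vertical_limit_at_0:
  assumes fs: "free_stable_distribution \<alpha> \<rho> \<nu>" and \<alpha>: "0 < \<alpha>"
  shows "(\<lambda>n. \<i> * complex_of_real (1 / real (Suc n)) *
    cauchy_transform \<nu> (\<i> * complex_of_real (1 / real (Suc n)))) \<longlonglongrightarrow> 0"
proof -
  interpret real_distribution \<nu>
    using fs by (simp add: free_stable_distribution_def)
  define z where "z = (\<lambda>n. \<i> * complex_of_real (1 / real (Suc n)))"
  define w where "w = (\<lambda>n. cauchy_transform \<nu> (z n))"
  have Im_z: "0 < Im (z n)" for n by (simp add: z_def)
  have w0: "w n \<noteq> 0" for n
    using Im_cauchy_transform_neg[OF Im_z[of n]] by (auto simp: w_def)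
  have "(\<lambda>n. 1 - z n * w n) \<longlonglongrightarrow> 1 - complex_of_real (prob {0})"
    unfolding z_def w_def by (intro tendsto_intros vertical_cauchy_transform_at_0)
  then have "Bseq (\<lambda>n. 1 - z n * w n)"
    by (intro convergent_imp_Bseq convergentI)
  then obtain C where C: "0 < C" "\<And>n. norm (1 - z n * w n) \<le> C"
    by (auto elim: BseqE)
  have bound: "norm (w n) \<le> exp (ln C / \<alpha>)" for n
  proof -
    have "exp (\<alpha> * ln (norm (w n))) = norm (1 - z n * w n)"
      using free_stable_cauchy_transform_eq[OF fs Im_z[of n]] w0[of n] by (simp add: w_def)
    also have "\<dots> \<le> exp (ln C)" using C by simp
    finally have "ln (norm (w n)) \<le> ln C / \<alpha>"
      using \<alpha> by (simp add: field_simps)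
    then have "exp (ln (norm (w n))) \<le> exp (ln C / \<alpha>)" by (simp only: exp_le_cancel_iff)
    then show ?thesis using w0[of n] by simp
  qed
  have "(\<lambda>n. z n * w n) \<longlonglongrightarrow> 0"
  proof (rule tendsto_norm_zero_cancel, rule tendsto_sandwich[OF _ _ tendsto_const])
    have "(\<lambda>n. inverse (real (Suc n)) * exp (ln C / \<alpha>)) \<longlonglongrightarrow> 0 * exp (ln C / \<alpha>)"
      by (intro tendsto_intros LIMSEQ_inverse_real_of_nat)
    then show "(\<lambda>n. inverse (real (Suc n)) * exp (ln C / \<alpha>)) \<longlonglongrightarrow> 0" by simp
    have "norm (z n * w n) \<le> inverse (real (Suc n)) * exp (ln C / \<alpha>)" for n
    proof -
      have "norm (z n) = inverse (real (Suc n))"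
        unfolding z_def norm_mult norm_of_real by (simp add: divide_inverse)
      then show ?thesis
        using mult_left_mono[OF bound[of n], of "inverse (real (Suc n))"] by (simp add: norm_mult)
    qed
    then show "\<forall>\<^sub>F n in sequentially. norm (z n * w n) \<le> inverse (real (Suc n)) * exp (ln C / \<alpha>)"
      by simp
  qed auto
  then show ?thesis by (simp add: z_def w_def)
qed

text \<open>
  As \<open>1 - z G z\<close> tends to \<open>1\<close>, where \<open>Ln\<close> is continuous with value \<open>0\<close>, the logarithmic form of
  the functional equation determines the limit of the argument of \<open>G z\<close>.
\<close>
lemma free_stable_primitive_at_0:
  assumes adm: "(\<alpha>, \<rho>) \<in> admissible" and fs: "free_stable_distribution \<alpha> \<rho> \<nu>"
  shows "(\<lambda>n. Im (free_stable_primitive \<alpha> \<nu> (\<i> * complex_of_real (1 / real (Suc n))))) \<longlonglongrightarrow> pi * \<rho>"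
proof -
  have \<alpha>: "0 < \<alpha>" by (rule admissible_bounds[OF adm])
  define z where "z = (\<lambda>n. \<i> * complex_of_real (1 / real (Suc n)))"
  define w where "w = (\<lambda>n. cauchy_transform \<nu> (z n))"
  have zw: "(\<lambda>n. z n * w n) \<longlonglongrightarrow> 0"
    using free_stable_vertical_limit_at_0[OF fs \<alpha>] by (simp add: z_def w_def)
  have "(\<lambda>n. Im (Ln (1 - z n * w n)) / \<alpha>) \<longlonglongrightarrow> Im (Ln (1 - 0)) / \<alpha>"
    using \<alpha> by (intro tendsto_intros zw) auto
  moreover have "Im (Ln (1 - z n * w n)) / \<alpha> = pi * \<rho> + Im (Ln (w n))" for n
    using free_stable_Ln_eq[OF adm fs, of "z n"] \<alpha> by (simp add: w_def z_def field_simps)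
  ultimately have lim: "(\<lambda>n. pi * \<rho> + Im (Ln (w n))) \<longlonglongrightarrow> 0"
    by simp
  have "(\<lambda>n. Im (complex_of_real (1 / \<alpha> - 1) * (1 - z n * w n)) + pi * \<rho> - (pi * \<rho> + Im (Ln (w n))))
      \<longlonglongrightarrow> Im (complex_of_real (1 / \<alpha> - 1) * (1 - 0)) + pi * \<rho> - 0"
    by (intro tendsto_intros zw lim)
  then show ?thesis
    by (simp add: free_stable_primitive_def z_def w_def)
qed

text \<open>
  The limit of \<open>z G z\<close> at \<open>0\<close> is the mass of the atom at \<open>0\<close> for every distribution, so its
  vanishing excludes this atom.
\<close>
lemma free_stable_prob_positive:
  assumes adm: "(\<alpha>, \<rho>) \<in> admissible" and fs: "free_stable_distribution \<alpha> \<rho> \<nu>"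
  shows "measure \<nu> {0<..} = \<rho>"
proof -
  interpret real_distribution \<nu>
    using fs by (simp add: free_stable_distribution_def)
  have \<alpha>: "0 < \<alpha>" by (rule admissible_bounds[OF adm])
  have no_atom: "prob {0} = 0"
    using LIMSEQ_unique[OF vertical_cauchy_transform_at_0 free_stable_vertical_limit_at_0[OF fs \<alpha>]]
    by simp
  obtain c where c: "\<And>y. 0 < y \<Longrightarrow>
      (\<integral>x. arctan (x / y) \<partial>\<nu>) = Im (free_stable_primitive \<alpha> \<nu> (\<i> * complex_of_real y)) + c"
    using integral_arctan_eq_Im_primitive[OF fs \<alpha>] by blast
  have "(\<lambda>n. \<integral>x. arctan (x / real (Suc n)) \<partial>\<nu>) \<longlonglongrightarrow> pi / 2 + c"
    using free_stable_primitive_at_infinity[OF fs] by (subst c) (auto intro!: tendsto_add)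
  with LIMSEQ_unique[OF integral_arctan_at_infinity] have "c = - (pi / 2)" by fastforce
  moreover have "(\<lambda>n. \<integral>x. arctan (x / (1 / real (Suc n))) \<partial>\<nu>) \<longlonglongrightarrow> pi * \<rho> + c"
    by (subst c) (use free_stable_primitive_at_0[OF adm fs] in \<open>auto intro!: tendsto_add\<close>)
  with LIMSEQ_unique[OF integral_arctan_at_0[OF no_atom]]
  have "pi * prob {0<..} - pi / 2 = pi * \<rho> + c" by blast
  ultimately show ?thesis by simp
qed

theorem corollary1:
  fixes \<alpha> \<rho> :: real and M :: "'a measure" and X :: "'a \<Rightarrow> real"
  assumes "(\<alpha>, \<rho>) \<in> admissible"
    and "prob_space M"
    and "X \<in> borel_measurable M"
    and "free_stable_distribution \<alpha> \<rho> (distr M borel X)"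
  shows "measure M {\<omega> \<in> space M. X \<omega> > 0} = \<rho>"
proof -
  have "measure (distr M borel X) {0<..} = measure M (X -` {0<..} \<inter> space M)"
    using assms(3) by (intro measure_distr) auto
  also have "X -` {0<..} \<inter> space M = {\<omega> \<in> space M. X \<omega> > 0}" by auto
  finally show ?thesis
    using free_stable_prob_positive[OF assms(1,4)] by simp
qed

end
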